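(* Let $\mathcal{A}=\{A_1,\ldots,A_m\}$ be an irreducible family of real $d\times d$ matrices, and let $\Pi_1,\ldots,\Pi_r$ be simple products of matrices from $\mathcal{A}$, pairwise different up to cyclic permutations. If the products $\Pi_1,\ldots,\Pi_r$ are dominant for $\mathcal{A}$ and have unique simple leading eigenvalues, then they have an admissible balancing vector, i.e. there exists an admissible vector $\alpha=(\alpha_1,\ldots,\alpha_r)$ with positive entries.
   Context: A family of matrices is irreducible if its matrices have no common nontrivial invariant subspace. Products of matrices from $\mathcal{A}$ are identified with words over the alphabet $\{1,\ldots,m\}$; the product $A_{d_n}\cdots A_{d_1}$ has length $n$. A product is simple if it is not a power of a shorter product. $\rho(\cdot)$ of a single matrix is its spectral radius. A leading eigenvalue of a matrix is an eigenvalue of maximal modulus; it is unique and simple if there is only one eigenvalue of maximal modulus and it has multiplicity one. **Dominance.** Let $n_i$ be the length of $\Pi_i$. The products $\Pi_1,\ldots,\Pi_r$ are dominant for $\mathcal{A}$ if all the numbers $[\rho(\Pi_i)]^{1/n_i}$ are equal (denote the common value, assumed positive, by $\rho_c$) and there is a constant $\gamma<1$ such that every product of matrices from the normalized family $\tilde{\mathcal{A}}=\{\tilde A_1,\ldots,\tilde A_m\}$, $\tilde A_i=\rho_c^{-1}A_i$, which is neither a power of some $\tilde\Pi_i=\rho_c^{-n_i}\Pi_i$ nor a power of a cyclic permutation of some $\tilde\Pi_i$ has spectral radius smaller than $\gamma$. **Leading eigenvectors and roots.** Each $\tilde\Pi_i$ is assumed to have the real leading eigenvalue $1$; $v_i\in\mathbb{R}^d$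 is a fixed corresponding eigenvector, and $v_i^*\in\mathbb{R}^d$ is the eigenvector of the adjoint $\tilde\Pi_i^*$ for the eigenvalue $1$, normalized by $(v_i^*,v_i)=1$. If $\tilde\Pi_i=\tilde A_{d_n}\cdots\tilde A_{d_1}$, $n=n_i$, put $v_i^{(1)}=v_i$, $v_i^{(j)}=\tilde A_{d_{j-1}}\cdots\tilde A_{d_1}v_i$ for $j=2,\ldots,n$, and $\mathcal{H}_i=\{v_i^{(1)},\ldots,v_i^{(n_i)}\}$. **Admissibility.** Put $$q_{ij}^{(\infty)}=\sup\{|(v_j^*,\tilde\Pi z)| : z\in\mathcal{H}_i,\ \tilde\Pi \text{ a product of } p\ge 0 \text{ matrices from }\tilde{\mathcal{A}}\}$$ (the empty product, $p=0$, is the identity). A balancing vector $\alpha=(\alpha_1,\ldots,\alpha_r)$, i.e. a vector with positive entries, is admissible if $\alpha_i\,q_{ij}^{(\infty)}<\alpha_j$ for all $i,j=1,\ldots,r$, $i\ne j$. *)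

theory Defs
  imports
    "Jordan_Normal_Form.Spectral_Radius"
    "Jordan_Normal_Form.VS_Connect"
    "HOL-Library.Extended_Real"
begin

text \<open>
  A family of \<open>m\<close> real \<open>d \<times> d\<close> matrices is a function \<open>A\<close> restricted to the indices
  \<open>{..<m}\<close>; likewise for \<open>r\<close>-tuples of words, vectors and coefficients. Products are
  identified with words, so powers, simplicity and cyclic permutations are notions about
  words and not about the resulting matrices.
\<close>

definition irreducible_family :: "nat \<Rightarrow> nat \<Rightarrow> (nat \<Rightarrow> real mat) \<Rightarrow> bool" where
  "irreducible_family d m A \<longleftrightarrow>
     (\<forall>W. VectorSpace.subspace class_ring W (module_vec TYPE(real) d) \<and>
          (\<forall>i<m. \<forall>x\<in>W. A i *\<^sub>v x \<in> W)
        \<longrightarrow> W = {0\<^sub>v d} \<or> W = carrier_vec d)"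

text \<open>
  Letters are listed in the order in which the matrices act on a column vector: the word
  \<open>[d\<^sub>1, \<dots>, d\<^sub>n]\<close> stands for the product \<open>A d\<^sub>n * \<dots> * A d\<^sub>1\<close>.
\<close>

primrec word_prod :: "nat \<Rightarrow> (nat \<Rightarrow> real mat) \<Rightarrow> nat list \<Rightarrow> real mat" where
  "word_prod d A [] = 1\<^sub>m d"
| "word_prod d A (k # w) = word_prod d A w * A k"

definition words :: "nat \<Rightarrow> nat list set" where
  "words m = {w. set w \<subseteq> {..<m}}"

abbreviation word_power :: "nat list \<Rightarrow> nat \<Rightarrow> nat list" where
  "word_power u k \<equiv> concat (replicate k u)"

definition simple_word :: "nat list \<Rightarrow> bool" where
  "simple_word w \<longleftrightarrow> w \<noteq> [] \<and> \<not> (\<exists>u k. length u < length w \<and> w = word_power u k)"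

definition cyclically_equal :: "nat list \<Rightarrow> nat list \<Rightarrow> bool" where
  "cyclically_equal u w \<longleftrightarrow> (\<exists>s. u = rotate s w)"

abbreviation cmat :: "real mat \<Rightarrow> complex mat" where
  "cmat \<equiv> map_mat complex_of_real"

definition leading_eigenvalue :: "real mat \<Rightarrow> complex \<Rightarrow> bool" where
  "leading_eigenvalue M z \<longleftrightarrow>
     eigenvalue (cmat M) z \<and> (\<forall>y. eigenvalue (cmat M) y \<longrightarrow> cmod y \<le> cmod z)"

definition unique_simple_leading_eigenvalue :: "real mat \<Rightarrow> bool" where
  "unique_simple_leading_eigenvalue M \<longleftrightarrow>
     (\<exists>!z. leading_eigenvalue M z) \<and>
     (\<forall>z. leading_eigenvalue M z \<longrightarrow> Polynomial.order z (char_poly (cmat M)) = 1)"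

definition normalized :: "real \<Rightarrow> (nat \<Rightarrow> real mat) \<Rightarrow> nat \<Rightarrow> real mat" where
  "normalized \<rho>c A i = inverse \<rho>c \<cdot>\<^sub>m A i"

text \<open>
  Only nonempty words count as products here: the empty word (the identity matrix, of
  spectral radius 1) is the zeroth power of every word.
\<close>

definition dominant ::
  "nat \<Rightarrow> nat \<Rightarrow> (nat \<Rightarrow> real mat) \<Rightarrow> nat \<Rightarrow> (nat \<Rightarrow> nat list) \<Rightarrow> real \<Rightarrow> bool" where
  "dominant d m A r p \<rho>c \<longleftrightarrow>
     \<rho>c > 0 \<and>
     (\<forall>i<r. root (length (p i)) (spectral_radius (cmat (word_prod d A (p i)))) = \<rho>c) \<and>
     (\<exists>\<gamma><1. \<forall>w\<in>words m.
        w \<noteq> [] \<and> \<not> (\<exists>i<r. \<exists>u k. cyclically_equal u (p i) \<and> w = word_power u k)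
        \<longrightarrow> spectral_radius (cmat (word_prod d (normalized \<rho>c A) w)) < \<gamma>)"

text \<open>
  In the following two definitions \<open>B\<close> is the normalized family. The vectors
  of the orbit \<open>v(1), \<dots>, v(n)\<close> correspond to \<open>j = 0, \<dots>, n - 1\<close>.
\<close>

definition orbit_set :: "nat \<Rightarrow> (nat \<Rightarrow> real mat) \<Rightarrow> nat list \<Rightarrow> real vec \<Rightarrow> real vec set" where
  "orbit_set d B w v = {word_prod d B (take j w) *\<^sub>v v | j. j < length w}"

text \<open>The supremum is taken in the extended reals, so that it is meaningful when infinite.\<close>

definition q_inf ::
  "nat \<Rightarrow> nat \<Rightarrow> (nat \<Rightarrow> real mat) \<Rightarrow> (nat \<Rightarrow> nat list) \<Rightarrow> (nat \<Rightarrow> real vec) \<Rightarrow> (nat \<Rightarrow> real vec)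
    \<Rightarrow> nat \<Rightarrow> nat \<Rightarrow> ereal" where
  "q_inf d m B p v vs i j =
     (SUP (z, u) \<in> orbit_set d B (p i) (v i) \<times> words m.
        ereal \<bar>vs j \<bullet> (word_prod d B u *\<^sub>v z)\<bar>)"

definition admissible :: "nat \<Rightarrow> (nat \<Rightarrow> nat \<Rightarrow> ereal) \<Rightarrow> (nat \<Rightarrow> real) \<Rightarrow> bool" where
  "admissible r q \<alpha> \<longleftrightarrow>
     (\<forall>i<r. \<alpha> i > 0) \<and>
     (\<forall>i<r. \<forall>j<r. i \<noteq> j \<longrightarrow> ereal (\<alpha> i) * q i j < ereal (\<alpha> j))"

end

theory Submission
  imports Defs
begin

text \<open>
  After normalization the powers of \<open>\<Pi>\<^sub>i\<close> converge to the rank-one projection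
  \<open>x \<mapsto> (v\<^sub>i\<^sup>*, x) v\<^sub>i\<close>. Writing \<open>q\<^sub>i\<^sub>j\<close> for the supremum of
  \<open>|(v\<^sub>j\<^sup>*, U v\<^sub>i)|\<close> over all products \<open>U\<close>, inserting high powers of \<open>\<Pi>\<^sub>i\<close>
  between two products gives \<open>q\<^sub>s\<^sub>i q\<^sub>i\<^sub>j \<le> q\<^sub>s\<^sub>j\<close>. The words
  \<open>\<Pi>\<^sub>i\<^sup>k U \<Pi>\<^sub>j\<^sup>k X\<close> with \<open>i \<noteq> j\<close> and large \<open>k\<close> are not powers of cyclic
  permutations of dominant products, so the spectral gap gives \<open>q\<^sub>i\<^sub>j q\<^sub>j\<^sub>i < 1\<close> in the limit;
  together with irreducibility this also shows that the \<open>q\<^sub>i\<^sub>j\<close> are finite. With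
  \<open>q\<^sub>j\<^sub>j\<close> replaced by \<open>1\<close>, the vector \<open>\<alpha>\<^sub>j = \<Sum>\<^sub>s q\<^sub>s\<^sub>j\<close> is then admissible: in
  \<open>\<alpha>\<^sub>i q\<^sub>i\<^sub>j = \<Sum>\<^sub>s q\<^sub>s\<^sub>i q\<^sub>i\<^sub>j\<close> no summand exceeds the corresponding one of \<open>\<alpha>\<^sub>j\<close>, and
  the one for \<open>s = j\<close> is strictly smaller.
\<close>

section \<open>Powers of matrices with a simple leading eigenvalue\<close>

text \<open>In a Schur form with \<open>e\<close> first on the diagonal, a simple \<open>e\<close>
  does not recur there, so back substitution annihilates every coordinate of an eigenvector except
  the first. Algebraic multiplicity one thus forces a one-dimensional eigenspace.\<close>

lemma order_one_eigenvectors_parallel: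
  fixes A :: "complex mat"
  assumes A: "A \<in> carrier_mat n n"
    and ord: "Polynomial.order e (char_poly A) = 1"
    and x: "eigenvector A x e" and y: "eigenvector A y e"
  shows "\<exists>c. x = c \<cdot>\<^sub>v y"
proof -
  obtain as where as: "char_poly A = (\<Prod>a\<leftarrow>as. [:- a, 1:])"
    using char_poly_factorized[OF A] by auto
  have "eigenvalue A e" using x by (auto simp: eigenvalue_def)
  then have "poly (char_poly A) e = 0" using eigenvalue_root_char_poly[OF A] by simp
  then have "e \<in> set as" unfolding as by (induction as) auto
  then obtain as1 as2 where split: "as = as1 @ e # as2" by (meson split_list)
  define es where "es = as1 @ as2"
  have cp: "char_poly A = (\<Prod>a\<leftarrow>e # es. [:- a, 1:])"
    unfolding as split es_def by (simp add: algebra_simps)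
  have nz: "(\<Prod>a\<leftarrow>es. [:- a, 1:]) \<noteq> 0" by (auto simp: prod_list_zero_iff)
  have nz': "[:- e, 1:] * (\<Prod>a\<leftarrow>es. [:- a, 1:]) \<noteq> 0" using nz
    by (metis mult_eq_0_iff pCons_eq_0_iff zero_neq_one)
  \<comment> \<open>The split-off copy of \<open>e\<close> uses up the whole multiplicity, so
    \<open>e\<close> is not a root of the remaining product.\<close>
  have "Polynomial.order e (\<Prod>a\<leftarrow>es. [:- a, 1:]) = 0"
    using ord order_mult[OF nz'] order_power_n_n[of e 1] unfolding cp by simp
  then have "poly (\<Prod>a\<leftarrow>es. [:- a, 1:]) e \<noteq> 0" using nz order_root by blast
  then have nmem: "e \<notin> set es" by (induction es) auto
  obtain B P Q where dec: "schur_decomposition A (e # es) = (B, P, Q)"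
    by (cases "schur_decomposition A (e # es)") auto
  note sd = schur_decomposition[OF A cp dec]
  have wit: "similar_mat_wit A B P Q" and ut: "upper_triangular B" and dg: "diag_mat B = e # es"
    using sd by auto
  note w = similar_mat_witD2[OF A wit]
  have B: "B \<in> carrier_mat n n" and P: "P \<in> carrier_mat n n" and Q: "Q \<in> carrier_mat n n"
    using w by auto
  have n0: "n > 0" and len: "length es = n - 1"
    using dg B by (auto simp: diag_mat_def dest: arg_cong[where f = length])
  have red: "z = P *\<^sub>v (Q *\<^sub>v z) \<and> (\<forall>i<n. i > 0 \<longrightarrow> (Q *\<^sub>v z) $ i = 0)" if z: "eigenvector A z e" for z
  proof -
    have zc: "z \<in> carrier_vec n" and Az: "A *\<^sub>v z = e \<cdot>\<^sub>v z"
      using z A by (auto simp: eigenvector_def)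
    define z' where "z' = Q *\<^sub>v z"
    have z'c: "z' \<in> carrier_vec n" using Q zc by (auto simp: z'_def)
    have "P *\<^sub>v z' = z" unfolding z'_def using assoc_mult_mat_vec[OF P Q zc] w zc by simp
    have "e \<cdot>\<^sub>v z' = Q *\<^sub>v (A *\<^sub>v z)" unfolding z'_def Az using mult_mat_vec[OF Q zc] by simp
    also have "A *\<^sub>v z = P *\<^sub>v (B *\<^sub>v z')"
    proof -
      have "A *\<^sub>v z = (P * (B * Q)) *\<^sub>v z" using w by simp
      also have "\<dots> = P *\<^sub>v (B *\<^sub>v z')" unfolding z'_def using P B Q zc
        by (simp add: assoc_mult_mat_vec[of _ n n _ n])
      finally show ?thesis .
    qed
    also have "Q *\<^sub>v (P *\<^sub>v (B *\<^sub>v z')) = (Q * P) *\<^sub>v (B *\<^sub>v z')"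
      using assoc_mult_mat_vec[OF Q P] B z'c by simp
    also have "\<dots> = B *\<^sub>v z'" using w B z'c by simp
    finally have Bz: "B *\<^sub>v z' = e \<cdot>\<^sub>v z'" by simp
    \<comment> \<open>The rows are treated from the bottom up: left of the diagonal \<open>B\<close>
      vanishes by triangularity, right of it the coordinates vanish by induction, and the diagonal
      entry lies in \<open>es\<close>, so it differs from \<open>e\<close>.\<close>
    have "z' $ i = 0" if "i < n" "i > 0" for i
      using that
    proof (induction "n - i" arbitrary: i rule: less_induct)
      case less
      have "e * z' $ i = (B *\<^sub>v z') $ i" using Bz less.prems z'c by simp
      also have "\<dots> = (\<Sum>j\<in>{0..<n}. B $$ (i, j) * z' $ j)"
        using less.prems B z'c by (simp add: scalar_prod_def)
      also have "\<dots> = (\<Sum>j\<in>{i}. B $$ (i, j) * z' $ j)"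
      proof (rule sum.mono_neutral_right)
        show "\<forall>j\<in>{0..<n} - {i}. B $$ (i, j) * z' $ j = 0"
        proof
          fix j assume j: "j \<in> {0..<n} - {i}"
          show "B $$ (i, j) * z' $ j = 0"
          proof (cases "j < i")
            case True
            then show ?thesis using ut less.prems B by (simp add: upper_triangular_def)
          next
            case False
            then have "j < n" "i < j" "n - j < n - i" using False less.prems j by auto
            then show ?thesis using less.hyps[of j] less.prems by simp
          qed
        qed
      qed (use less.prems in auto)
      finally have eq: "e * z' $ i = B $$ (i, i) * z' $ i" by simp
      have "B $$ (i, i) = diag_mat B ! i" using B less.prems by (simp add: diag_mat_def)
      also have "\<dots> = (e # es) ! i" by (simp only: dg)
      also have "\<dots> = es ! (i - 1)" using less.prems by (simp add: nth_Cons')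
      finally have "B $$ (i, i) \<in> set es" using len less.prems by simp
      then show ?case using eq nmem by auto
    qed
    then show ?thesis using \<open>P *\<^sub>v z' = z\<close> unfolding z'_def by auto
  qed
  have xc: "x \<in> carrier_vec n" and yc: "y \<in> carrier_vec n" and y0: "y \<noteq> 0\<^sub>v n"
    using x y A by (auto simp: eigenvector_def)
  define x' y' where "x' = Q *\<^sub>v x" and "y' = Q *\<^sub>v y"
  have x'c: "x' \<in> carrier_vec n" and y'c: "y' \<in> carrier_vec n"
    using Q xc yc by (auto simp: x'_def y'_def)
  have "y' $ 0 \<noteq> 0"
  proof
    assume "y' $ 0 = 0"
    then have "y' $ i = 0" if "i < n" for i
      using red[OF y] that unfolding y'_def[symmetric] by (cases "i = 0") auto
    then have "y' = 0\<^sub>v n" using y'c by (intro eq_vecI) auto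
    moreover have "P *\<^sub>v 0\<^sub>v n = 0\<^sub>v n" using P by (intro eq_vecI) auto
    ultimately have "y = 0\<^sub>v n" using red[OF y] unfolding y'_def[symmetric] by simp
    then show False using y0 by simp
  qed
  \<comment> \<open>Only coordinate 0 of \<open>x'\<close> and \<open>y'\<close> can be nonzero, so
    the ratio of these two coordinates is the required factor.\<close>
  define c where "c = x' $ 0 / y' $ 0"
  have "x' $ i = c * y' $ i" if "i < n" for i
    using red[OF x] red[OF y] that \<open>y' $ 0 \<noteq> 0\<close>
    unfolding c_def x'_def[symmetric] y'_def[symmetric] by (cases "i = 0") auto
  then have "x' = c \<cdot>\<^sub>v y'" using x'c y'c by (intro eq_vecI) auto
  then have "P *\<^sub>v x' = c \<cdot>\<^sub>v (P *\<^sub>v y')" using mult_mat_vec[OF P y'c] by simp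
  then have "x = c \<cdot>\<^sub>v y"
    using red[OF x] red[OF y] unfolding x'_def[symmetric] y'_def[symmetric] by simp
  then show ?thesis by blast
qed

section \<open>Powers of matrices with spectral radius below one\<close>

lemma smult_pow_mat:
  fixes A :: "'a :: comm_ring_1 mat"
  assumes A: "A \<in> carrier_mat n n"
  shows "(c \<cdot>\<^sub>m A) ^\<^sub>m k = c ^ k \<cdot>\<^sub>m (A ^\<^sub>m k)"
proof (induction k)
  case 0
  then show ?case using A by auto
next
  case (Suc k)
  have Ak: "A ^\<^sub>m k \<in> carrier_mat n n" using A by simp
  show ?case using Suc A Ak
    by (auto intro!: eq_matI simp: mult_smult_distrib[OF _ A] mult_smult_assoc_mat[OF Ak] ac_simps)
qed

lemma eigenvector_smultD:
  fixes A :: "'a :: field mat"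
  assumes A: "A \<in> carrier_mat n n" and c: "c \<noteq> 0"
    and ev: "eigenvector (c \<cdot>\<^sub>m A) x e"
  shows "eigenvector A x (e / c)"
proof -
  have x: "x \<in> carrier_vec n" "x \<noteq> 0\<^sub>v n" "(c \<cdot>\<^sub>m A) *\<^sub>v x = e \<cdot>\<^sub>v x"
    using ev A by (auto simp: eigenvector_def)
  have "c \<cdot>\<^sub>v (A *\<^sub>v x) = e \<cdot>\<^sub>v x" using x A by (auto intro!: eq_vecI simp: vec_eq_iff)
  then have "inverse c \<cdot>\<^sub>v (c \<cdot>\<^sub>v (A *\<^sub>v x)) = (e / c) \<cdot>\<^sub>v x"
    by (simp add: smult_smult_assoc divide_inverse mult.commute)
  then show ?thesis using x A c by (simp add: eigenvector_def smult_smult_assoc)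
qed

text \<open>Choose \<delta> strictly between the spectral radius and 1. Dividing by \<delta> keeps
  the spectral radius below 1, so the powers of the rescaled matrix are bounded and those of
  \<open>A\<close> decay like the powers of \<delta>.\<close>

lemma pow_mat_tendsto_0:
  fixes A :: "complex mat"
  assumes A: "A \<in> carrier_mat n n" and n: "n > 0"
    and small: "\<And>e. eigenvalue A e \<Longrightarrow> cmod e < 1"
    and i: "i < n" and j: "j < n"
  shows "(\<lambda>k. (A ^\<^sub>m k) $$ (i, j)) \<longlonglongrightarrow> 0"
proof -
  have "spectral_radius A \<in> norm ` spectrum A" by (rule spectral_radius_mem_max[OF A n])
  then have sr: "spectral_radius A < 1" "spectral_radius A \<ge> 0"
    using small by (auto simp: spectrum_def)
  obtain \<delta> where d: "spectral_radius A < \<delta>" "\<delta> < 1" using sr dense by blast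
  have d0: "\<delta> > 0" using d sr by simp
  define C where "C = complex_of_real (1 / \<delta>) \<cdot>\<^sub>m A"
  have C: "C \<in> carrier_mat n n" using A by (simp add: C_def)
  have "spectral_radius C \<in> norm ` spectrum C" by (rule spectral_radius_mem_max[OF C n])
  then obtain e where e: "eigenvalue C e" "spectral_radius C = cmod e" by (auto simp: spectrum_def)
  have "eigenvalue A (e / complex_of_real (1 / \<delta>))"
    using e(1) eigenvector_smultD[OF A, of "complex_of_real (1 / \<delta>)"] d0
    unfolding C_def eigenvalue_def by fastforce
  then have "cmod (e / complex_of_real (1 / \<delta>)) \<le> spectral_radius A"
    using spectral_radius_mem_max(2)[OF A n] by (auto simp: spectrum_def)
  then have "cmod e * \<delta> \<le> spectral_radius A" using d0 by (simp add: norm_mult)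
  then have "cmod e * \<delta> < \<delta>" using d by linarith
  then have "cmod e < 1" using d0 by (simp add: mult_less_cancel_right1)
  then have "spectral_radius C < 1" using d0 e(2) by simp
  then obtain c where c: "\<And>k. norm_bound (C ^\<^sub>m k) c"
    using spectral_radius_jnf_norm_bound_less_1_upper_triangular[OF C] by blast
  have bd: "norm ((A ^\<^sub>m k) $$ (i, j)) \<le> c * \<delta> ^ k" for k
  proof -
    have "C ^\<^sub>m k = complex_of_real (1 / \<delta>) ^ k \<cdot>\<^sub>m (A ^\<^sub>m k)"
      unfolding C_def by (rule smult_pow_mat[OF A])
    then have "(C ^\<^sub>m k) $$ (i, j) = complex_of_real (1 / \<delta>) ^ k * (A ^\<^sub>m k) $$ (i, j)"
      using A i j by simp
    moreover have "norm ((C ^\<^sub>m k) $$ (i, j)) \<le> c"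
      using c[of k] C i j by (simp add: norm_bound_def)
    ultimately have "(1 / \<delta>) ^ k * norm ((A ^\<^sub>m k) $$ (i, j)) \<le> c"
      using d0 by (simp add: norm_mult norm_power norm_divide)
    then show ?thesis using d0 by (simp add: field_simps)
  qed
  have "(\<lambda>k. c * \<delta> ^ k) \<longlonglongrightarrow> c * 0"
    by (intro tendsto_intros LIMSEQ_power_zero) (use d d0 in auto)
  then have lim: "(\<lambda>k. c * \<delta> ^ k) \<longlonglongrightarrow> 0" by simp
  show ?thesis
    by (rule tendsto_0_le[OF lim, where K = 1])
      (intro always_eventually allI order_trans[OF bd], simp)
qed

section \<open>Entrywise limits of matrices\<close>

text \<open>The size is an explicit parameter because the type \<open>real mat\<close> does not fix
  it; the carrier conditions keep products and determinants along the sequence well behaved.\<close>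

definition mat_tendsto :: "nat \<Rightarrow> (nat \<Rightarrow> real mat) \<Rightarrow> real mat \<Rightarrow> bool" where
  "mat_tendsto d F L \<longleftrightarrow> (\<forall>k. F k \<in> carrier_mat d d) \<and> L \<in> carrier_mat d d \<and>
     (\<forall>i<d. \<forall>j<d. (\<lambda>k. F k $$ (i, j)) \<longlonglongrightarrow> L $$ (i, j))"

lemma mat_tendsto_const: "M \<in> carrier_mat d d \<Longrightarrow> mat_tendsto d (\<lambda>k. M) M"
  by (simp add: mat_tendsto_def)

lemma mat_tendsto_mult:
  assumes "mat_tendsto d F L" and "mat_tendsto d G M"
  shows "mat_tendsto d (\<lambda>k. F k * G k) (L * M)"
proof -
  note a = assms[unfolded mat_tendsto_def]
  have "(\<lambda>k. (F k * G k) $$ (i, j)) \<longlonglongrightarrow> (L * M) $$ (i, j)" if ij: "i < d" "j < d" for i j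
  proof -
    have expand: "(X * Y) $$ (i, j) = (\<Sum>l = 0..<d. X $$ (i, l) * Y $$ (l, j))"
      if "X \<in> carrier_mat d d" "Y \<in> carrier_mat d d" for X Y :: "real mat"
      using that ij by (simp add: scalar_prod_def)
    have "(\<lambda>k. \<Sum>l = 0..<d. F k $$ (i, l) * G k $$ (l, j))
        \<longlonglongrightarrow> (\<Sum>l = 0..<d. L $$ (i, l) * M $$ (l, j))"
      by (intro tendsto_sum tendsto_mult) (use a ij in auto)
    then show ?thesis using a by (simp add: expand)
  qed
  moreover have "F k * G k \<in> carrier_mat d d" "L * M \<in> carrier_mat d d" for k
    using a by (metis mult_carrier_mat)+
  ultimately show ?thesis by (simp add: mat_tendsto_def)
qed

lemma tendsto_scalar_prod_mult_mat_vec: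
  assumes "mat_tendsto d F L" and "w \<in> carrier_vec d" and "x \<in> carrier_vec d"
  shows "(\<lambda>k. w \<bullet> (F k *\<^sub>v x)) \<longlonglongrightarrow> w \<bullet> (L *\<^sub>v x)"
proof -
  note a = assms[unfolded mat_tendsto_def]
  have expand: "w \<bullet> (X *\<^sub>v x) = (\<Sum>i = 0..<d. w $ i * (\<Sum>j = 0..<d. X $$ (i, j) * x $ j))"
    if "X \<in> carrier_mat d d" for X
    using that assms(2,3) by (simp add: scalar_prod_def)
  have "(\<lambda>k. \<Sum>i = 0..<d. w $ i * (\<Sum>j = 0..<d. F k $$ (i, j) * x $ j))
      \<longlonglongrightarrow> (\<Sum>i = 0..<d. w $ i * (\<Sum>j = 0..<d. L $$ (i, j) * x $ j))"
    by (intro tendsto_sum tendsto_mult tendsto_const) (use a in auto)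
  then show ?thesis using a by (simp add: expand)
qed

lemma mat_tendsto_det:
  assumes "mat_tendsto d F L"
  shows "(\<lambda>k. det (F k)) \<longlonglongrightarrow> det L"
proof -
  note a = assms[unfolded mat_tendsto_def]
  have "(\<lambda>k. \<Sum>p\<in>{p. p permutes {0..<d}}. signof p * (\<Prod>i = 0..<d. F k $$ (i, p i)))
      \<longlonglongrightarrow> (\<Sum>p\<in>{p. p permutes {0..<d}}. signof p * (\<Prod>i = 0..<d. L $$ (i, p i)))"
    by (intro tendsto_sum tendsto_mult tendsto_prod tendsto_const)
      (use a permutes_in_image in \<open>fastforce\<close>)
  then show ?thesis using a by (simp add: det_def'[where n = d])
qed

section \<open>Rank-one projections as limits of powers\<close>

definition outer_prod :: "nat \<Rightarrow> 'a :: comm_ring_1 vec \<Rightarrow> 'a vec \<Rightarrow> 'a mat" where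
  "outer_prod d v w = mat d d (\<lambda>(i, j). v $ i * w $ j)"

lemma outer_prod_carrier [simp]: "outer_prod d v w \<in> carrier_mat d d"
  by (simp add: outer_prod_def)

lemma outer_prod_mult_vec:
  assumes "v \<in> carrier_vec d" and "w \<in> carrier_vec d" and "x \<in> carrier_vec d"
  shows "outer_prod d v w *\<^sub>v x = (w \<bullet> x) \<cdot>\<^sub>v v"
  using assms
  by (intro eq_vecI) (auto simp: outer_prod_def scalar_prod_def sum_distrib_left sum_distrib_right ac_simps)

lemma mult_mat_zero_vec: "A \<in> carrier_mat n m \<Longrightarrow> A *\<^sub>v 0\<^sub>v m = 0\<^sub>v n"
  by (intro eq_vecI) auto

lemma mat_eqI_mult_vec:
  fixes A B :: "'a :: comm_ring_1 mat"
  assumes A: "A \<in> carrier_mat n m" and B: "B \<in> carrier_mat n m"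
    and eq: "\<And>x. x \<in> carrier_vec m \<Longrightarrow> A *\<^sub>v x = B *\<^sub>v x"
  shows "A = B"
proof (rule eq_matI)
  fix i j assume ij: "i < dim_row B" "j < dim_col B"
  have "(A *\<^sub>v unit_vec m j) $ i = (B *\<^sub>v unit_vec m j) $ i" using eq by simp
  then show "A $$ (i, j) = B $$ (i, j)" using ij A B by simp
qed (use A B in auto)

lemma scalar_prod_mult_mat_vec_fixed:
  fixes P :: "'a :: comm_ring_1 mat"
  assumes P: "P \<in> carrier_mat d d" and w: "w \<in> carrier_vec d" and x: "x \<in> carrier_vec d"
    and Pw: "P\<^sup>T *\<^sub>v w = w"
  shows "w \<bullet> (P *\<^sub>v x) = w \<bullet> x"
  using transpose_vec_mult_scalar[OF P x w] Pw by simp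

text \<open>Deflation: subtracting the projection \<open>outer_prod d v w\<close> removes the
  eigenvalue 1 and leaves a matrix \<open>Q\<close> with all eigenvalues inside the unit disc. Since
  the powers of \<open>P\<close> and \<open>Q\<close> differ by this projection, the claim reduces
  to the decay of the powers of \<open>Q\<close>.\<close>

lemma pow_mat_tendsto_outer_prod:
  fixes P :: "real mat"
  assumes d: "d > 0" and P: "P \<in> carrier_mat d d"
    and v: "v \<in> carrier_vec d" and w: "w \<in> carrier_vec d"
    and Pv: "P *\<^sub>v v = v" and Pw: "P\<^sup>T *\<^sub>v w = w" and wv: "w \<bullet> v = 1"
    and lead: "\<And>e. eigenvalue (cmat P) e \<Longrightarrow> cmod e \<ge> 1 \<Longrightarrow> e = 1"
    and par: "\<And>x. eigenvector (cmat P) x 1 \<Longrightarrow> \<exists>c. x = c \<cdot>\<^sub>v map_vec complex_of_real v"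
  shows "mat_tendsto d (\<lambda>k. P ^\<^sub>m k) (outer_prod d v w)"
proof -
  define Q where "Q = P - outer_prod d v w"
  have Q: "Q \<in> carrier_mat d d" unfolding Q_def by (rule minus_carrier_mat) simp
  define vC wC where "vC = map_vec complex_of_real v" and "wC = map_vec complex_of_real w"
  have vC: "vC \<in> carrier_vec d" and wC: "wC \<in> carrier_vec d" using v w by (auto simp: vC_def wC_def)
  have PC: "cmat P \<in> carrier_mat d d" and QC: "cmat Q \<in> carrier_mat d d" using P Q by auto
  have PwC: "(cmat P)\<^sup>T *\<^sub>v wC = wC"
    using of_real_hom.mult_mat_vec_hom[of "P\<^sup>T" d d w, where 'a = complex] P w Pw
    by (simp add: wC_def map_mat_transpose)
  have wvC: "wC \<bullet> vC = 1"
  proof -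
    have "wC \<bullet> vC = complex_of_real (w \<bullet> v)"
      using v w by (simp add: wC_def vC_def scalar_prod_def)
    then show ?thesis using wv by simp
  qed
  have Qx: "cmat Q *\<^sub>v x = cmat P *\<^sub>v x - (wC \<bullet> x) \<cdot>\<^sub>v vC" if x: "x \<in> carrier_vec d" for x
  proof -
    have "cmat Q = cmat P - outer_prod d vC wC"
      using P v w by (intro eq_matI) (auto simp: Q_def outer_prod_def vC_def wC_def)
    then show ?thesis
      using minus_mult_distrib_mat_vec[OF PC outer_prod_carrier x] outer_prod_mult_vec[OF vC wC x] by simp
  qed
  have small: "cmod e < 1" if Qe: "eigenvalue (cmat Q) e" for e
  proof (rule ccontr)
    assume big: "\<not> cmod e < 1"
    obtain x where x: "x \<in> carrier_vec d" "x \<noteq> 0\<^sub>v d" and ev: "cmat Q *\<^sub>v x = e \<cdot>\<^sub>v x"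
      using Qe carrier_matD(1)[OF Q] unfolding eigenvalue_def eigenvector_def by auto
    \<comment> \<open>Pairing with the left eigenvector \<open>wC\<close> annihilates
      \<open>cmat Q\<close>. As \<open>e\<close> is nonzero, \<open>x\<close> is orthogonal to
      \<open>wC\<close>, so it is an eigenvector of \<open>cmat P\<close> as well; being then a
      multiple of \<open>vC\<close>, it has to vanish.\<close>
    have "e * (wC \<bullet> x) = wC \<bullet> (cmat Q *\<^sub>v x)" using ev wC x by simp
    also have "\<dots> = wC \<bullet> (cmat P *\<^sub>v x) - (wC \<bullet> x) * (wC \<bullet> vC)"
      unfolding Qx[OF x(1)] using wC vC x PC by (subst scalar_prod_minus_distrib[of _ d]) auto
    also have "\<dots> = 0" using scalar_prod_mult_mat_vec_fixed[OF PC wC x(1) PwC] wvC by simp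
    finally have wx: "wC \<bullet> x = 0" using big by auto
    then have "cmat P *\<^sub>v x = e \<cdot>\<^sub>v x" using Qx[OF x(1)] ev PC vC x(1)
      by (intro eq_vecI) (auto simp: vec_eq_iff)
    then have ev': "eigenvector (cmat P) x e" using x P by (auto simp: eigenvector_def)
    then have "e = 1" using lead[of e] big by (auto simp: eigenvalue_def)
    then obtain c where c: "x = c \<cdot>\<^sub>v vC" using par ev' unfolding vC_def by blast
    then have "c = 0" using wx wvC wC vC by simp
    then show False using c x vC by auto
  qed
  have Qv: "Q *\<^sub>v v = 0\<^sub>v d"
    using minus_mult_distrib_mat_vec[OF P outer_prod_carrier v, of v w]
      outer_prod_mult_vec[OF v w v] Pv wv v unfolding Q_def by simp
  \<comment> \<open>The exponent starts at 1: for exponent 0 both powers are the identity and the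
    projection would be left over.\<close>
  have Qk: "P ^\<^sub>m Suc k = outer_prod d v w + Q ^\<^sub>m Suc k" for k
  proof (induction k)
    case 0
    show ?case using P v w by (intro eq_matI) (auto simp: Q_def outer_prod_def)
  next
    case (Suc k)
    have Qk: "Q ^\<^sub>m Suc k \<in> carrier_mat d d" using Q by (metis pow_carrier_mat)
    have QQ: "Q ^\<^sub>m k \<in> carrier_mat d d" using Q by (metis pow_carrier_mat)
    show ?case
    proof (rule mat_eqI_mult_vec)
      fix x :: "real vec" assume x: "x \<in> carrier_vec d"
      have Px: "P *\<^sub>v x \<in> carrier_vec d" using P x by simp
      have Px': "P *\<^sub>v x = Q *\<^sub>v x + (w \<bullet> x) \<cdot>\<^sub>v v"
        using minus_mult_distrib_mat_vec[OF P outer_prod_carrier x, of v w] P v x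
        unfolding Q_def outer_prod_mult_vec[OF v w x] by (intro eq_vecI) auto
      \<comment> \<open>\<open>Q\<close> annihilates \<open>v\<close>, and \<open>P\<close> differs
        from \<open>Q\<close> by a map into the multiples of \<open>v\<close>; after a positive
        power of \<open>Q\<close>, applying \<open>P\<close> first or \<open>Q\<close> first makes
        no difference.\<close>
      have "Q ^\<^sub>m Suc k *\<^sub>v v = 0\<^sub>v d"
        using assoc_mult_mat_vec[OF QQ Q v] Qv mult_mat_zero_vec[OF QQ] by simp
      then have "Q ^\<^sub>m Suc k *\<^sub>v (P *\<^sub>v x) = Q ^\<^sub>m Suc k *\<^sub>v (Q *\<^sub>v x)"
        unfolding Px' using mult_add_distrib_mat_vec[OF Qk, of "Q *\<^sub>v x" "(w \<bullet> x) \<cdot>\<^sub>v v"]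
          mult_mat_vec[OF Qk v] Q Qk v x by (auto intro!: eq_vecI)
      moreover have "P ^\<^sub>m Suc (Suc k) *\<^sub>v x = (outer_prod d v w + Q ^\<^sub>m Suc k) *\<^sub>v (P *\<^sub>v x)"
        unfolding Suc[symmetric] using P x
        by (subst pow_mat.simps(2), subst assoc_mult_mat_vec[of _ d d _ d])
          (auto simp del: pow_mat.simps intro: pow_carrier_mat)
      moreover have "\<dots> = outer_prod d v w *\<^sub>v (P *\<^sub>v x) + Q ^\<^sub>m Suc k *\<^sub>v (P *\<^sub>v x)"
        by (rule add_mult_distrib_mat_vec[OF outer_prod_carrier Qk Px])
      moreover have "outer_prod d v w *\<^sub>v (P *\<^sub>v x) = outer_prod d v w *\<^sub>v x"
        unfolding outer_prod_mult_vec[OF v w Px] outer_prod_mult_vec[OF v w x]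
        using scalar_prod_mult_mat_vec_fixed[OF P w x Pw] by simp
      moreover have "(outer_prod d v w + Q ^\<^sub>m Suc (Suc k)) *\<^sub>v x
          = outer_prod d v w *\<^sub>v x + Q ^\<^sub>m Suc k *\<^sub>v (Q *\<^sub>v x)"
        using add_mult_distrib_mat_vec[OF outer_prod_carrier _ x, of "Q ^\<^sub>m Suc (Suc k)" v w]
          assoc_mult_mat_vec[OF Qk Q x] Qk Q by simp
      ultimately show "P ^\<^sub>m Suc (Suc k) *\<^sub>v x = (outer_prod d v w + Q ^\<^sub>m Suc (Suc k)) *\<^sub>v x"
        by simp
    qed (use P Q in \<open>auto simp del: pow_mat.simps intro: pow_carrier_mat add_carrier_mat\<close>)
  qed
  have "(\<lambda>k. (P ^\<^sub>m k) $$ (i, j)) \<longlonglongrightarrow> outer_prod d v w $$ (i, j)" if ij: "i < d" "j < d" for i j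
  proof -
    have "(\<lambda>k. complex_of_real ((Q ^\<^sub>m k) $$ (i, j))) \<longlonglongrightarrow> complex_of_real 0"
      using pow_mat_tendsto_0[OF QC d small ij] Q ij by (simp flip: of_real_hom.mat_hom_pow[OF Q])
    then have "(\<lambda>k. (Q ^\<^sub>m k) $$ (i, j)) \<longlonglongrightarrow> 0" by (simp only: tendsto_of_real_iff)
    then have "(\<lambda>k. outer_prod d v w $$ (i, j) + (Q ^\<^sub>m Suc k) $$ (i, j))
        \<longlonglongrightarrow> outer_prod d v w $$ (i, j) + 0"
      by (intro tendsto_add tendsto_const LIMSEQ_Suc)
    moreover have "(P ^\<^sub>m Suc k) $$ (i, j) = outer_prod d v w $$ (i, j) + (Q ^\<^sub>m Suc k) $$ (i, j)" for k
      unfolding Qk using Q ij by (simp del: pow_mat.simps)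
    ultimately have "(\<lambda>k. (P ^\<^sub>m Suc k) $$ (i, j)) \<longlonglongrightarrow> outer_prod d v w $$ (i, j)"
      by (simp only: add_0_right)
    then show ?thesis by (rule LIMSEQ_imp_Suc)
  qed
  then show ?thesis using P by (auto simp: mat_tendsto_def)
qed

section \<open>Spectral radius bounds under limits\<close>

text \<open>The characteristic polynomial splits over the complex numbers into \<open>d\<close>
  factors, and each root lies at distance at least \<open>\<bar>c\<bar> - g\<close> from
  \<open>c\<close>. The bound depends on \<open>M\<close> only through \<open>d\<close> and
  \<open>g\<close>, hence it passes to limits.\<close>

lemma abs_poly_char_poly_ge:
  fixes M :: "real mat"
  assumes M: "M \<in> carrier_mat d d" and d: "d > 0"
    and sr: "spectral_radius (cmat M) \<le> g" and c: "\<bar>c\<bar> \<ge> g"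
  shows "\<bar>poly (char_poly M) c\<bar> \<ge> (\<bar>c\<bar> - g) ^ d"
proof -
  have C: "cmat M \<in> carrier_mat d d" using M by simp
  obtain as where as: "char_poly (cmat M) = (\<Prod>a\<leftarrow>as. [:- a, 1:])" and len: "length as = d"
    using char_poly_factorized[OF C] by auto
  have bd: "cmod a \<le> g" if "a \<in> set as" for a
  proof -
    have "poly (char_poly (cmat M)) a = 0" unfolding as using that by (induction as) auto
    then have "a \<in> spectrum (cmat M)" using spectrum_root_char_poly[OF C] by simp
    then show ?thesis using spectral_radius_mem_max(2)[OF C d] sr by fastforce
  qed
  have "\<bar>poly (char_poly M) c\<bar> = cmod (poly (char_poly (cmat M)) (complex_of_real c))"
    by (simp add: of_real_hom.char_poly_hom[OF M])
  also have "\<dots> \<ge> (\<bar>c\<bar> - g) ^ length as" unfolding as using bd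
  proof (induction as)
    case (Cons a as)
    have "\<bar>c\<bar> - g \<le> cmod (complex_of_real c - a)"
      using Cons.prems[of a] norm_triangle_ineq2[of "complex_of_real c" a] by simp
    then have "(\<bar>c\<bar> - g) * (\<bar>c\<bar> - g) ^ length as
        \<le> cmod (complex_of_real c - a) * cmod (poly (\<Prod>a\<leftarrow>as. [:- a, 1:]) (complex_of_real c))"
      using Cons c by (intro mult_mono) auto
    then show ?case by (simp add: norm_mult left_diff_distrib[symmetric])
  qed simp
  finally show ?thesis using len by simp
qed

text \<open>The value of the characteristic polynomial at \<open>c\<close> is a determinant, hence
  continuous in the matrix. If \<open>\<bar>c\<bar>\<close> exceeded \<open>g\<close>, these values
  would stay away from 0 along the sequence, yet their limit is 0.\<close>

lemma eigenvalue_limit_le_spectral_radius: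
  assumes d: "d > 0" and F: "mat_tendsto d F L" and c: "eigenvalue L c"
    and sr: "eventually (\<lambda>k. spectral_radius (cmat (F k)) \<le> g) sequentially"
  shows "\<bar>c\<bar> \<le> g"
proof (rule ccontr)
  assume gc: "\<not> \<bar>c\<bar> \<le> g"
  have Fk: "\<And>k. F k \<in> carrier_mat d d" and L: "L \<in> carrier_mat d d"
    using F by (auto simp: mat_tendsto_def)
  have dims: "dim_row (F k) = d" "dim_col (F k) = d" for k using Fk[of k] by auto
  have "mat_tendsto d (\<lambda>k. - char_matrix (F k) c) (- char_matrix L c)"
    using F dims by (auto simp: mat_tendsto_def char_matrix_def intro!: tendsto_intros)
  then have "(\<lambda>k. poly (char_poly (F k)) c) \<longlonglongrightarrow> poly (char_poly L) c"
    unfolding char_poly_matrix[OF Fk] char_poly_matrix[OF L] by (rule mat_tendsto_det)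
  then have lim: "(\<lambda>k. \<bar>poly (char_poly (F k)) c\<bar>) \<longlonglongrightarrow> 0"
    using c eigenvalue_root_char_poly[OF L] by (simp add: tendsto_rabs_zero)
  have "eventually (\<lambda>k. (\<bar>c\<bar> - g) ^ d \<le> \<bar>poly (char_poly (F k)) c\<bar>) sequentially"
    using sr by eventually_elim (use abs_poly_char_poly_ge[OF Fk d] gc in auto)
  then have "(\<bar>c\<bar> - g) ^ d \<le> 0" using lim tendsto_lowerbound by fastforce
  then show False using gc by (metis diff_gt_0_iff_gt linorder_not_le zero_less_power)
qed

section \<open>Leading eigenvalues under scaling\<close>

lemma eigenvector_smult_iff:
  fixes A :: "'a :: field mat"
  assumes A: "A \<in> carrier_mat n n" and c: "c \<noteq> 0"
  shows "eigenvector (c \<cdot>\<^sub>m A) x (c * e) \<longleftrightarrow> eigenvector A x e"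
proof
  assume "eigenvector (c \<cdot>\<^sub>m A) x (c * e)"
  then show "eigenvector A x e" using eigenvector_smultD[OF A c, of x "c * e"] c by simp
next
  assume "eigenvector A x e"
  moreover have "inverse c \<cdot>\<^sub>m (c \<cdot>\<^sub>m A) = A" using c by (intro eq_matI) auto
  ultimately have "eigenvector (inverse c \<cdot>\<^sub>m (c \<cdot>\<^sub>m A)) x e" by simp
  then show "eigenvector (c \<cdot>\<^sub>m A) x (c * e)"
    using eigenvector_smultD[of "c \<cdot>\<^sub>m A" n "inverse c" x e] A c by (simp add: divide_inverse mult.commute)
qed

lemma leading_eigenvalue_smultD:
  assumes M: "M \<in> carrier_mat n n" and c: "c \<noteq> 0" and lead: "leading_eigenvalue (c \<cdot>\<^sub>m M) e"
  shows "leading_eigenvalue M (e / complex_of_real c)"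
proof -
  have C: "cmat (c \<cdot>\<^sub>m M) = complex_of_real c \<cdot>\<^sub>m cmat M" by (intro eq_matI) auto
  have CM: "cmat M \<in> carrier_mat n n" and cC: "complex_of_real c \<noteq> 0" using M c by auto
  note iff = eigenvector_smult_iff[OF CM cC]
  have "eigenvalue (cmat M) (e / complex_of_real c)"
    using lead iff[of _ "e / complex_of_real c"] cC by (auto simp: leading_eigenvalue_def C eigenvalue_def)
  moreover have "cmod y \<le> cmod (e / complex_of_real c)" if "eigenvalue (cmat M) y" for y
  proof -
    have "eigenvalue (cmat (c \<cdot>\<^sub>m M)) (complex_of_real c * y)"
      using that iff[of _ y] by (auto simp: C eigenvalue_def)
    then have "\<bar>c\<bar> * cmod y \<le> cmod e" using lead by (auto simp: leading_eigenvalue_def norm_mult)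
    then show ?thesis using c by (simp add: norm_divide field_simps)
  qed
  ultimately show ?thesis by (simp add: leading_eigenvalue_def)
qed

text \<open>Uniqueness and simplicity are given for the original product \<open>M\<close>, the
  eigenvalue 1 and its eigenvectors for the normalized one. Scaling preserves the order of moduli
  and the multiplicities, so both kinds of information combine.\<close>

lemma pow_mat_tendsto_leading_projection:
  assumes d: "d > 0" and M: "M \<in> carrier_mat d d" and c: "c \<noteq> 0"
    and unique: "unique_simple_leading_eigenvalue M"
    and lead: "leading_eigenvalue (c \<cdot>\<^sub>m M) 1"
    and v: "eigenvector (c \<cdot>\<^sub>m M) v 1" and w: "eigenvector (c \<cdot>\<^sub>m M)\<^sup>T w 1" and wv: "w \<bullet> v = 1"
  shows "mat_tendsto d (\<lambda>k. (c \<cdot>\<^sub>m M) ^\<^sub>m k) (outer_prod d v w)"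
proof (rule pow_mat_tendsto_outer_prod[OF d])
  show P: "c \<cdot>\<^sub>m M \<in> carrier_mat d d" using M by simp
  show "v \<in> carrier_vec d" "w \<in> carrier_vec d" "(c \<cdot>\<^sub>m M) *\<^sub>v v = v" "(c \<cdot>\<^sub>m M)\<^sup>T *\<^sub>v w = w"
    using v w M by (auto simp: eigenvector_def)
  show "w \<bullet> v = 1" by (rule wv)
  have C: "cmat (c \<cdot>\<^sub>m M) = complex_of_real c \<cdot>\<^sub>m cmat M" by (intro eq_matI) auto
  show "e = 1" if e: "eigenvalue (cmat (c \<cdot>\<^sub>m M)) e" "cmod e \<ge> 1" for e
  proof -
    \<comment> \<open>No eigenvalue exceeds 1 in modulus, so one of modulus at least 1 is leading
      too; uniqueness for \<open>M\<close> then identifies it with 1.\<close>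
    have "leading_eigenvalue (c \<cdot>\<^sub>m M) e"
      using e lead unfolding leading_eigenvalue_def by fastforce
    then have "leading_eigenvalue M (e / complex_of_real c)" "leading_eigenvalue M (1 / complex_of_real c)"
      using leading_eigenvalue_smultD[OF M c] lead by auto
    then have "e / complex_of_real c = 1 / complex_of_real c"
      using unique unfolding unique_simple_leading_eigenvalue_def by blast
    then show ?thesis using c by simp
  qed
  have "Polynomial.order 1 (char_poly (cmat (c \<cdot>\<^sub>m M)))
      = Polynomial.order (1 / complex_of_real c) (char_poly (cmat M))"
    unfolding C using M c by (intro order_char_poly_smult[of _ d]) auto
  also have "\<dots> = 1"
    using leading_eigenvalue_smultD[OF M c lead] unique
    unfolding unique_simple_leading_eigenvalue_def by blast
  finally have ord: "Polynomial.order 1 (char_poly (cmat (c \<cdot>\<^sub>m M))) = 1" .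
  have vC: "eigenvector (cmat (c \<cdot>\<^sub>m M)) (map_vec complex_of_real v) 1"
    using of_real_hom.eigenvector_hom[OF P v, where 'a = complex] by simp
  show "\<exists>a. x = a \<cdot>\<^sub>v map_vec complex_of_real v" if "eigenvector (cmat (c \<cdot>\<^sub>m M)) x 1" for x
    using P by (intro order_one_eigenvectors_parallel[OF _ ord that vC]) auto
qed

section \<open>Powers of words\<close>

lemma rotate1_word_power: "rotate1 (word_power u k) = word_power (rotate1 u) k"
proof (cases u)
  case (Cons a t)
  have shift: "word_power (a # t) k @ [a] = a # word_power (t @ [a]) k" for k
    by (induction k) auto
  show ?thesis
  proof (cases k)
    case (Suc k')
    then show ?thesis using shift[of k'] Cons by simp
  qed simp
qed simp

lemma rotate_word_power: "rotate n (word_power u k) = word_power (rotate n u) k"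
  by (induction n) (simp_all add: rotate1_word_power)

lemma length_word_power [simp]: "length (word_power u k) = k * length u"
  by (induction k) auto

lemma word_power_add: "word_power u (a + b) = word_power u a @ word_power u b"
  by (simp add: replicate_add)

lemma rotate_undo: "\<exists>t. rotate t (rotate s q) = q"
proof (cases "q = []")
  case False
  \<comment> \<open>\<open>length q * s\<close> is a multiple of the length and at least
    \<open>s\<close>, so rotating by the difference completes full turns.\<close>
  have "s \<le> length q * s" using False by (cases q) auto
  then have "rotate (length q * s - s) (rotate s q) = rotate (length q * s) q"
    by (simp add: rotate_rotate)
  also have "\<dots> = q" by (subst rotate_conv_mod) simp
  finally show ?thesis by blast
qed simp

section \<open>Common powers of simple words\<close>

text \<open>The square of the common power can be read as beginning with \<open>p @ u\<close> and as
  beginning with \<open>u @ p\<close>; these prefixes have the same length, hence coincide.\<close>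

lemma common_power_imp_commute:
  assumes eq: "word_power p a = word_power u b" and "a > 0" and "b > 0"
  shows "p @ u = u @ p"
proof -
  obtain a' b' where ab: "a = Suc a'" "b = Suc b'" using assms gr0_implies_Suc by metis
  have square: "word_power z (Suc c) @ word_power z (Suc c) = z @ word_power z (Suc c) @ word_power z c"
    for z :: "nat list" and c
    using word_power_add[of "Suc c" "Suc c" z] word_power_add[of "Suc (Suc c)" c z] by simp
  have p: "word_power p a @ word_power p a = p @ word_power u b @ word_power p a'"
    unfolding eq[symmetric] unfolding ab by (rule square)
  have u: "word_power u b @ word_power u b = u @ word_power p a @ word_power u b'"
    unfolding eq unfolding ab by (rule square)
  have "(p @ u) @ word_power u b' @ word_power p a' = p @ word_power u b @ word_power p a'"
    unfolding ab by simp
  also have "\<dots> = u @ word_power p a @ word_power u b'" unfolding p[symmetric] u[symmetric] by (simp only: eq)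
  also have "\<dots> = (u @ p) @ word_power p a' @ word_power u b'" unfolding ab by simp
  finally have "(p @ u) @ word_power u b' @ word_power p a' = (u @ p) @ word_power p a' @ word_power u b'" .
  then show ?thesis by (subst (asm) append_eq_append_conv) auto
qed

lemma simple_word_power_1:
  assumes "simple_word w" and "w = word_power u k"
  shows "w = u"
proof -
  have w: "w \<noteq> []" "\<not> length u < length w" using assms unfolding simple_word_def by blast+
  then have "k * length u \<le> length u" "k \<noteq> 0" "u \<noteq> []" using assms(2) by auto
  then have "k = 1" by (cases k) auto
  then show ?thesis using assms(2) by simp
qed

lemma simple_word_rotate:
  assumes "simple_word w"
  shows "simple_word (rotate s w)"
proof -
  obtain t where t: "rotate t (rotate s w) = w" using rotate_undo by blast
  have False if "length u < length w" "rotate s w = word_power u k" for u k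
  proof -
    have "w = word_power (rotate t u) k" using t that(2) rotate_word_power by metis
    moreover have "length (rotate t u) < length w" using that(1) by simp
    ultimately show False using assms unfolding simple_word_def by blast
  qed
  then show ?thesis using assms unfolding simple_word_def by auto
qed

text \<open>Words with a common power commute, so both are powers of a single word, and a simple
  word that is a power equals its base.\<close>

lemma common_power_imp_eq:
  assumes "simple_word p" and "simple_word u"
    and "word_power p a = word_power u b" and "a > 0" and "b > 0"
  shows "p = u"
proof -
  obtain m n z where "concat (replicate m z) = p" "concat (replicate n z) = u"
    using comm_append_are_replicate[OF common_power_imp_commute[OF assms(3-5)]] by blast
  then show ?thesis using simple_word_power_1 assms(1,2) by metis
qed

text \<open>The prefix of length \<open>length p * length u\<close> is a power of \<open>p\<close>
  when read on the left and a power of \<open>u\<close> when read on the right. The bound on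
  \<open>k\<close> ensures that this prefix ends before \<open>x\<close> starts.\<close>

lemma power_prefix_of_power:
  assumes p: "simple_word p" and u: "simple_word u"
    and eq: "word_power p k @ x = word_power u n" and k: "k \<ge> length u"
  shows "p = u"
proof -
  have p0: "length p > 0" and u0: "length u > 0" using p u by (auto simp: simple_word_def)
  have "k * length p + length x = n * length u" using arg_cong[OF eq, of length] by simp
  then have "length p * length u \<le> n * length u"
    using mult_le_mono1[OF k, of "length p"] mult.commute[of "length p" "length u"] by linarith
  then have n: "length p \<le> n" using u0 by simp
  have "take (length p * length u) (word_power p k @ x) = word_power p (length u)"
    using word_power_add[of "length u" "k - length u" p] k by (simp add: mult.commute)
  moreover have "take (length p * length u) (word_power u n) = word_power u (length p)"
    using word_power_add[of "length p" "n - length p" u] n by simp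
  ultimately have "word_power p (length u) = word_power u (length p)" using eq by simp
  then show ?thesis using common_power_imp_eq[OF p u] p0 u0 by blast
qed

text \<open>The first block is a prefix of a power of \<open>u\<close>, which gives
  \<open>p = u\<close>. Rotating the whole word brings the second block to the front and makes
  \<open>q\<close> a rotation of \<open>u\<close>.\<close>

lemma two_powers_in_power_imp_cyclically_equal:
  assumes p: "simple_word p" and q: "simple_word q" and l: "simple_word l"
    and u: "cyclically_equal u l"
    and eq: "word_power p k @ x @ word_power q k @ y = word_power u n" and k: "k \<ge> length l"
  shows "cyclically_equal p q"
proof -
  obtain s where s: "u = rotate s l" using u by (auto simp: cyclically_equal_def)
  have ul: "simple_word u" "length u = length l" using simple_word_rotate[OF l] s by auto
  have pu: "p = u" using power_prefix_of_power[OF p ul(1) eq] k ul by simp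
  define N where "N = length (word_power p k @ x)"
  have "word_power q k @ y @ word_power p k @ x = rotate N ((word_power p k @ x) @ (word_power q k @ y))"
    unfolding N_def by (subst rotate_append) simp
  also have "\<dots> = word_power (rotate N u) n" using eq by (simp add: rotate_word_power)
  finally have "q = rotate N u"
    using power_prefix_of_power[OF q simple_word_rotate[OF ul(1)]] k ul by simp
  then show ?thesis using pu rotate_undo[of N u] unfolding cyclically_equal_def by metis
qed

section \<open>Dominant products\<close>

text \<open>The suprema are taken one factor at a time: dividing by \<open>F x\<close> bounds the
  supremum of \<open>G\<close>, and dividing by that supremum bounds \<open>F\<close>. Zero factors
  are treated separately.\<close>

lemma cSUP_mult_cSUP_le:
  fixes F :: "'a \<Rightarrow> real" and G :: "'b \<Rightarrow> real"
  assumes U: "U \<noteq> {}" and V: "V \<noteq> {}" "bdd_above (G ` V)"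
    and F: "\<And>x. x \<in> U \<Longrightarrow> F x \<ge> 0" and G: "\<And>y. y \<in> V \<Longrightarrow> G y \<ge> 0"
    and le: "\<And>x y. x \<in> U \<Longrightarrow> y \<in> V \<Longrightarrow> F x * G y \<le> c"
  shows "(SUP x\<in>U. F x) * (SUP y\<in>V. G y) \<le> c"
proof -
  obtain x0 y0 where x0: "x0 \<in> U" and y0: "y0 \<in> V" using U V by blast
  have c: "c \<ge> 0" using le[OF x0 y0] F[OF x0] G[OF y0] mult_nonneg_nonneg order_trans by blast
  have "(SUP y\<in>V. G y) \<ge> 0" using cSUP_upper[OF y0 V(2)] G[OF y0] by linarith
  then consider "(SUP y\<in>V. G y) = 0" | "(SUP y\<in>V. G y) > 0" by linarith
  then show ?thesis
  proof cases
    case 2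
    have "F x * (SUP y\<in>V. G y) \<le> c" if x: "x \<in> U" for x
    proof (cases "F x = 0")
      case False
      then have Fx: "F x > 0" using F[OF x] by simp
      then have "(SUP y\<in>V. G y) \<le> c / F x"
        using le[OF x] by (intro cSUP_least[OF V(1)]) (simp add: field_simps)
      then show ?thesis using Fx by (simp add: field_simps)
    qed (use c in simp)
    then have "(SUP x\<in>U. F x) \<le> c / (SUP y\<in>V. G y)"
      using 2 by (intro cSUP_least[OF U]) (simp add: field_simps)
    then show ?thesis using 2 by (simp add: field_simps)
  qed (use c in simp)
qed

lemma words_append [simp]: "u @ x \<in> words m \<longleftrightarrow> u \<in> words m \<and> x \<in> words m"
  by (auto simp: words_def)

lemma words_Nil [simp]: "[] \<in> words m"
  by (simp add: words_def)

lemma words_nonempty: "words m \<noteq> {}"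
  using words_Nil by blast

lemma words_power: "u \<in> words m \<Longrightarrow> word_power u k \<in> words m"
  by (induction k) auto

lemma word_prod_carrier_mat:
  assumes "\<forall>k<m. B k \<in> carrier_mat d d" and "u \<in> words m"
  shows "word_prod d B u \<in> carrier_mat d d"
  using assms(2)
proof (induction u)
  case (Cons a u)
  then have "a < m" "u \<in> words m" by (auto simp: words_def)
  then show ?case using Cons.IH assms(1) by (auto intro: mult_carrier_mat)
qed simp

section \<open>Pairings of the normalized family\<close>

text \<open>This isolates what the argument uses: \<open>lim\<close> condenses the spectral
  assumptions on the products, \<open>gap\<close> is dominance, and \<open>connected\<close> is the
  consequence of irreducibility. In the application \<open>B\<close> is the normalized family and
  \<open>w i\<close> the adjoint eigenvector.\<close>

locale dominant_family =
  fixes d m r :: nat and B :: "nat \<Rightarrow> real mat" and p :: "nat \<Rightarrow> nat list"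
    and v w :: "nat \<Rightarrow> real vec" and \<gamma> :: real
  assumes d: "d > 0" and B: "\<And>k. k < m \<Longrightarrow> B k \<in> carrier_mat d d"
    and p_words: "\<And>i. i < r \<Longrightarrow> p i \<in> words m"
    and simple: "\<And>i. i < r \<Longrightarrow> simple_word (p i)"
    and distinct: "\<And>i j. i < r \<Longrightarrow> j < r \<Longrightarrow> i \<noteq> j \<Longrightarrow> \<not> cyclically_equal (p i) (p j)"
    and v: "\<And>i. i < r \<Longrightarrow> v i \<in> carrier_vec d" and w: "\<And>i. i < r \<Longrightarrow> w i \<in> carrier_vec d"
    and lim: "\<And>i. i < r \<Longrightarrow> mat_tendsto d (\<lambda>k. word_prod d B (p i) ^\<^sub>m k) (outer_prod d (v i) (w i))"
    and \<gamma>: "\<gamma> < 1"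
    and gap: "\<And>u. u \<in> words m \<Longrightarrow> u \<noteq> [] \<Longrightarrow>
       \<not> (\<exists>i<r. \<exists>x k. cyclically_equal x (p i) \<and> u = word_power x k) \<Longrightarrow>
       spectral_radius (cmat (word_prod d B u)) < \<gamma>"
    and connected: "\<And>i j. i < r \<Longrightarrow> j < r \<Longrightarrow> \<exists>u\<in>words m. w j \<bullet> (word_prod d B u *\<^sub>v v i) \<noteq> 0"
begin

definition pairing :: "nat \<Rightarrow> nat \<Rightarrow> nat list \<Rightarrow> real" where
  "pairing i j u = w j \<bullet> (word_prod d B u *\<^sub>v v i)"

lemma word_prod_carrier: "u \<in> words m \<Longrightarrow> word_prod d B u \<in> carrier_mat d d"
  by (rule word_prod_carrier_mat) (use B in auto)

lemma word_prod_append: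
  assumes "u \<in> words m" and "x \<in> words m"
  shows "word_prod d B (u @ x) = word_prod d B x * word_prod d B u"
  using assms
proof (induction u)
  case Nil
  then show ?case using word_prod_carrier[of x] by simp
next
  case (Cons a u)
  then have "B a \<in> carrier_mat d d" "u \<in> words m" by (auto simp: words_def intro: B)
  then show ?case using Cons word_prod_carrier[of u] word_prod_carrier[of x]
    by (simp add: assoc_mult_mat[of _ d d _ d _ d])
qed

lemma word_prod_power:
  assumes "u \<in> words m"
  shows "word_prod d B (word_power u k) = word_prod d B u ^\<^sub>m k"
proof (induction k)
  case 0
  then show ?case using word_prod_carrier[OF assms] by simp
next
  case (Suc k)
  then show ?case using word_prod_append[OF assms words_power[OF assms]] by simp
qed

lemma word_prod_mult_vec: "u \<in> words m \<Longrightarrow> i < r \<Longrightarrow> word_prod d B u *\<^sub>v v i \<in> carrier_vec d"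
  by (rule mult_mat_vec_carrier[OF word_prod_carrier v])

text \<open>In the limit the inserted power becomes the rank-one map
  \<open>outer_prod d (v i) (w i)\<close>, which cuts the word at \<open>v i\<close> and splits the
  pairing into two factors.\<close>

lemma tendsto_pairing_insert_power:
  assumes i: "i < r" and j: "j < r" and s: "s < r" and u: "u \<in> words m" and x: "x \<in> words m"
  shows "(\<lambda>k. pairing s j (u @ word_power (p i) k @ x)) \<longlonglongrightarrow> pairing s i u * pairing i j x"
proof -
  let ?U = "word_prod d B u" and ?X = "word_prod d B x" and ?O = "outer_prod d (v i) (w i)"
  note U = word_prod_carrier[OF u] and X = word_prod_carrier[OF x]
  have wp: "word_prod d B (u @ word_power (p i) k @ x) = ?X * (word_prod d B (p i) ^\<^sub>m k * ?U)" for k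
    using word_prod_carrier[OF p_words[OF i]] U X
    by (simp add: word_prod_append u x words_power p_words[OF i] word_prod_power
        assoc_mult_mat[of _ d d _ d _ d] mult_carrier_mat[of _ d d _ d] pow_carrier_mat)
  have "mat_tendsto d (\<lambda>k. ?X * (word_prod d B (p i) ^\<^sub>m k * ?U)) (?X * (?O * ?U))"
    by (intro mat_tendsto_mult mat_tendsto_const U X lim[OF i])
  then have "(\<lambda>k. w j \<bullet> (?X * (word_prod d B (p i) ^\<^sub>m k * ?U) *\<^sub>v v s))
      \<longlonglongrightarrow> w j \<bullet> (?X * (?O * ?U) *\<^sub>v v s)"
    by (rule tendsto_scalar_prod_mult_mat_vec[OF _ w[OF j] v[OF s]])
  moreover have "w j \<bullet> (?X * (?O * ?U) *\<^sub>v v s) = pairing s i u * pairing i j x"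
  proof -
    have "?X * (?O * ?U) *\<^sub>v v s = ?X *\<^sub>v (?O *\<^sub>v (?U *\<^sub>v v s))"
      using U X v[OF s] by (simp add: assoc_mult_mat_vec[of _ d d _ d] mult_carrier_mat[of _ d d _ d]
        mult_mat_vec_carrier[of _ d d])
    also have "\<dots> = pairing s i u \<cdot>\<^sub>v (?X *\<^sub>v v i)"
      unfolding outer_prod_mult_vec[OF v[OF i] w[OF i] word_prod_mult_vec[OF u s]] pairing_def
      by (rule mult_mat_vec[OF X v[OF i]])
    finally show ?thesis using w[OF j] word_prod_mult_vec[OF x i] by (simp add: pairing_def)
  qed
  ultimately show ?thesis by (simp add: pairing_def wp)
qed

text \<open>With growing \<open>k\<close> the matrices of \<open>word k\<close> converge to a matrix
  \<open>L\<close> that has the product of the two pairings as a real eigenvalue. For large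
  \<open>k\<close> the gap applies to \<open>word k\<close>, and its bound passes to the limit. The
  maximum with 0 covers the case of a vanishing product.\<close>

lemma abs_pairing_mult_pairing_le:
  assumes i: "i < r" and j: "j < r" and ij: "i \<noteq> j" and u: "u \<in> words m" and x: "x \<in> words m"
  shows "\<bar>pairing i j u * pairing j i x\<bar> \<le> max \<gamma> 0"
proof (cases "pairing i j u * pairing j i x = 0")
  case False
  let ?U = "word_prod d B u" and ?X = "word_prod d B x"
  let ?O = "\<lambda>i. outer_prod d (v i) (w i)"
  define word where "word k = word_power (p i) k @ u @ word_power (p j) k @ x" for k
  note U = word_prod_carrier[OF u] and X = word_prod_carrier[OF x]
  define L where "L = ?X * (?O j * (?U * ?O i))"
  have word: "word k \<in> words m" for k
    by (simp add: word_def u x words_power p_words i j)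
  have wp: "word_prod d B (word k)
      = ?X * (word_prod d B (p j) ^\<^sub>m k * (?U * word_prod d B (p i) ^\<^sub>m k))" for k
    using word_prod_carrier[OF p_words[OF i]] word_prod_carrier[OF p_words[OF j]] U X
    unfolding word_def
    by (simp add: word_prod_append u x words_power p_words i j word_prod_power
        assoc_mult_mat[of _ d d _ d _ d] mult_carrier_mat[of _ d d _ d] pow_carrier_mat)
  have conv: "mat_tendsto d (\<lambda>k. word_prod d B (word k)) L"
    unfolding wp L_def by (intro mat_tendsto_mult mat_tendsto_const U X lim i j)
  \<comment> \<open>The range of \<open>L\<close> consists of multiples of this vector, so it is the
    candidate eigenvector; it is nonzero because its pairing with \<open>w i\<close> is
    \<open>pairing j i x\<close>.\<close>
  define y where "y = ?X *\<^sub>v v j"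
  have y: "y \<in> carrier_vec d" using word_prod_mult_vec[OF x j] by (simp add: y_def)
  have fy: "pairing j i x = w i \<bullet> y" by (simp add: pairing_def y_def)
  have "L *\<^sub>v y = ?X *\<^sub>v (?O j *\<^sub>v (?U *\<^sub>v (?O i *\<^sub>v y)))"
    unfolding L_def using U X y by (simp add: assoc_mult_mat_vec[of _ d d _ d] mult_carrier_mat[of _ d d _ d]
        mult_mat_vec_carrier[of _ d d])
  also have "?O i *\<^sub>v y = pairing j i x \<cdot>\<^sub>v v i"
    using outer_prod_mult_vec[OF v[OF i] w[OF i] y] by (simp add: fy)
  also have "?U *\<^sub>v (pairing j i x \<cdot>\<^sub>v v i) = pairing j i x \<cdot>\<^sub>v (?U *\<^sub>v v i)"
    by (rule mult_mat_vec[OF U v[OF i]])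
  also have "?O j *\<^sub>v (pairing j i x \<cdot>\<^sub>v (?U *\<^sub>v v i)) = (pairing i j u * pairing j i x) \<cdot>\<^sub>v v j"
    using outer_prod_mult_vec[OF v[OF j] w[OF j], of "pairing j i x \<cdot>\<^sub>v (?U *\<^sub>v v i)"]
      word_prod_mult_vec[OF u i] w[OF j] by (simp add: pairing_def mult.commute)
  also have "?X *\<^sub>v ((pairing i j u * pairing j i x) \<cdot>\<^sub>v v j) = (pairing i j u * pairing j i x) \<cdot>\<^sub>v y"
    unfolding y_def by (rule mult_mat_vec[OF X v[OF j]])
  finally have Ly: "L *\<^sub>v y = (pairing i j u * pairing j i x) \<cdot>\<^sub>v y" .
  have "y \<noteq> 0\<^sub>v d" using False fy w[OF i] by auto
  moreover have L: "L \<in> carrier_mat d d" using conv by (simp add: mat_tendsto_def)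
  ultimately have ev: "eigenvalue L (pairing i j u * pairing j i x)"
    using Ly y unfolding eigenvalue_def eigenvector_def by auto
  \<comment> \<open>\<open>K\<close> bounds the lengths of all \<open>p l\<close>, so one threshold
    for \<open>k\<close> serves every \<open>l\<close>; the \<open>Suc\<close> below makes
    \<open>k\<close> positive and thus \<open>word k\<close> nonempty.\<close>
  define K where "K = (\<Sum>l<r. length (p l))"
  have "spectral_radius (cmat (word_prod d B (word k))) \<le> max \<gamma> 0" if k: "k \<ge> Suc K" for k
  proof -
    have "word k \<noteq> []" using simple[OF i] k by (cases k) (auto simp: word_def simple_word_def)
    moreover have "\<not> (\<exists>l<r. \<exists>z n. cyclically_equal z (p l) \<and> word k = word_power z n)"
    proof clarify
      fix l z n assume l: "l < r" and z: "cyclically_equal z (p l)" and eq: "word k = word_power z n"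
      have "length (p l) \<le> K" unfolding K_def using l by (intro member_le_sum) auto
      then have "cyclically_equal (p i) (p j)"
        using two_powers_in_power_imp_cyclically_equal[OF simple[OF i] simple[OF j] simple[OF l] z
            eq[unfolded word_def]] k by simp
      then show False using distinct[OF i j ij] by blast
    qed
    ultimately show ?thesis using gap[OF word] by (meson max.coboundedI1 less_imp_le)
  qed
  then have "eventually (\<lambda>k. spectral_radius (cmat (word_prod d B (word k))) \<le> max \<gamma> 0) sequentially"
    by (auto simp: eventually_sequentially)
  then show ?thesis by (rule eigenvalue_limit_le_spectral_radius[OF d conv ev])
next
  case True
  then show ?thesis unfolding True by simp
qed

section \<open>Suprema of pairings\<close>

text \<open>The supremum is real-valued and is used for distinct indices, for which the set is
  bounded by \<open>bdd_above_pairing\<close>.\<close>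

definition pairing_sup :: "nat \<Rightarrow> nat \<Rightarrow> real" where
  "pairing_sup i j = (SUP u\<in>words m. \<bar>pairing i j u\<bar>)"

text \<open>A return word \<open>x\<close> with nonzero pairing is fixed by connectedness; dividing
  the bound on the product by this pairing gives a bound independent of \<open>u\<close>.\<close>

lemma bdd_above_pairing:
  assumes i: "i < r" and j: "j < r" and ij: "i \<noteq> j"
  shows "bdd_above ((\<lambda>u. \<bar>pairing i j u\<bar>) ` words m)"
proof -
  obtain x where x: "x \<in> words m" "pairing j i x \<noteq> 0" using connected[OF j i] by (auto simp: pairing_def)
  have "\<bar>pairing i j u\<bar> \<le> max \<gamma> 0 / \<bar>pairing j i x\<bar>" if "u \<in> words m" for u
    using abs_pairing_mult_pairing_le[OF i j ij that x(1)] x(2) by (simp add: field_simps abs_mult)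
  then show ?thesis by (rule bdd_aboveI2)
qed

lemma abs_pairing_le_pairing_sup:
  "i < r \<Longrightarrow> j < r \<Longrightarrow> i \<noteq> j \<Longrightarrow> u \<in> words m \<Longrightarrow> \<bar>pairing i j u\<bar> \<le> pairing_sup i j"
  unfolding pairing_sup_def by (intro cSUP_upper bdd_above_pairing)

lemma pairing_sup_nonneg: "i < r \<Longrightarrow> j < r \<Longrightarrow> i \<noteq> j \<Longrightarrow> pairing_sup i j \<ge> 0"
  using abs_pairing_le_pairing_sup[of i j "[]"] by simp

text \<open>Passing through \<open>v i\<close> on the way from \<open>s\<close> to \<open>j\<close>
  is approximated by the words \<open>u @ word_power (p i) k @ x\<close>, whose pairings are all
  bounded by \<open>pairing_sup s j\<close>.\<close>

lemma pairing_sup_mult_pairing_sup_le: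
  assumes "i < r" "j < r" "s < r" "s \<noteq> i" "i \<noteq> j" "s \<noteq> j"
  shows "pairing_sup s i * pairing_sup i j \<le> pairing_sup s j"
  unfolding pairing_sup_def[of s i] pairing_sup_def[of i j]
proof (rule cSUP_mult_cSUP_le)
  fix u x assume u: "u \<in> words m" and x: "x \<in> words m"
  have "(\<lambda>k. \<bar>pairing s j (u @ word_power (p i) k @ x)\<bar>) \<longlonglongrightarrow> \<bar>pairing s i u * pairing i j x\<bar>"
    by (intro tendsto_rabs tendsto_pairing_insert_power assms u x)
  then have "\<bar>pairing s i u * pairing i j x\<bar> \<le> pairing_sup s j"
    by (rule LIMSEQ_le_const2)
      (auto intro!: exI[of _ 0] abs_pairing_le_pairing_sup simp: assms u x words_power p_words)
  then show "\<bar>pairing s i u\<bar> * \<bar>pairing i j x\<bar> \<le> pairing_sup s j" by (simp add: abs_mult)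
qed (use bdd_above_pairing assms words_nonempty in auto)

text \<open>The bound \<open>max \<gamma> 0\<close> is uniform in both words, so it survives the
  suprema and strictness is retained.\<close>

lemma pairing_sup_mult_pairing_sup_less_1:
  assumes "i < r" "j < r" "i \<noteq> j"
  shows "pairing_sup i j * pairing_sup j i < 1"
proof -
  have "pairing_sup i j * pairing_sup j i \<le> max \<gamma> 0"
    unfolding pairing_sup_def
    by (rule cSUP_mult_cSUP_le)
      (use bdd_above_pairing assms words_nonempty abs_pairing_mult_pairing_le[OF assms] in \<open>auto simp: abs_mult\<close>)
  then show ?thesis using \<gamma> by simp
qed

text \<open>Each orbit point is the image of \<open>v i\<close> under a prefix of
  \<open>p i\<close>; joining this prefix to \<open>u\<close> gives a word already counted in
  \<open>pairing_sup i j\<close>.\<close>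

lemma q_inf_le_pairing_sup:
  assumes i: "i < r" and j: "j < r" and ij: "i \<noteq> j"
  shows "q_inf d m B p v w i j \<le> ereal (pairing_sup i j)"
  unfolding q_inf_def
proof (rule SUP_least, clarify)
  fix z u assume z: "z \<in> orbit_set d B (p i) (v i)" and u: "u \<in> words m"
  then obtain l where zl: "z = word_prod d B (take l (p i)) *\<^sub>v v i" by (auto simp: orbit_set_def)
  have t: "take l (p i) \<in> words m" using p_words[OF i] set_take_subset[of l "p i"] by (auto simp: words_def)
  have "w j \<bullet> (word_prod d B u *\<^sub>v z) = pairing i j (take l (p i) @ u)"
    unfolding zl pairing_def word_prod_append[OF t u]
    using assoc_mult_mat_vec[OF word_prod_carrier[OF u] word_prod_carrier[OF t] v[OF i]] by simp
  then show "ereal \<bar>w j \<bullet> (word_prod d B u *\<^sub>v z)\<bar> \<le> ereal (pairing_sup i j)"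
    using abs_pairing_le_pairing_sup[OF i j ij, of "take l (p i) @ u"] t u by simp
qed

section \<open>The admissible vector\<close>

definition weight :: "nat \<Rightarrow> real" where
  "weight j = (\<Sum>s<r. if s = j then 1 else pairing_sup s j)"

lemma weight_pos: "j < r \<Longrightarrow> weight j > 0"
  unfolding weight_def by (rule sum_pos2[where i = j]) (auto simp: pairing_sup_nonneg)

lemma weight_mult_pairing_sup_less:
  assumes i: "i < r" and j: "j < r" and ij: "i \<noteq> j"
  shows "weight i * pairing_sup i j < weight j"
proof -
  have "weight i * pairing_sup i j = (\<Sum>s<r. (if s = i then 1 else pairing_sup s i) * pairing_sup i j)"
    unfolding weight_def by (rule sum_distrib_right)
  also have "\<dots> < weight j"
    unfolding weight_def
  proof (rule sum_strict_mono_ex1)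
    \<comment> \<open>For \<open>s = i\<close> both sides agree, for \<open>s = j\<close> the left
      side is a product below 1, and for other \<open>s\<close> the submultiplicative inequality
      through \<open>i\<close> applies.\<close>
    show "\<forall>s\<in>{..<r}. (if s = i then 1 else pairing_sup s i) * pairing_sup i j
        \<le> (if s = j then 1 else pairing_sup s j)"
      using pairing_sup_mult_pairing_sup_le[OF i j] pairing_sup_mult_pairing_sup_less_1[OF j i] ij
      by (auto simp: less_imp_le)
    show "\<exists>s\<in>{..<r}. (if s = i then 1 else pairing_sup s i) * pairing_sup i j
        < (if s = j then 1 else pairing_sup s j)"
      using pairing_sup_mult_pairing_sup_less_1[OF j i] i j ij by (intro bexI[of _ j]) auto
  qed simp
  finally show ?thesis .
qed

lemma admissible_weight: "admissible r (q_inf d m B p v w) weight"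
  unfolding admissible_def
proof (intro conjI allI impI)
  fix i j assume i: "i < r" and j: "j < r" and ij: "i \<noteq> j"
  \<comment> \<open>Comparison with the finite \<open>pairing_sup i j\<close> moves the inequality
    from the extended reals to the reals.\<close>
  have "ereal (weight i) * q_inf d m B p v w i j \<le> ereal (weight i) * ereal (pairing_sup i j)"
    using weight_pos[OF i] by (intro ereal_mult_left_mono q_inf_le_pairing_sup i j ij) simp
  also have "\<dots> < ereal (weight j)" using weight_mult_pairing_sup_less[OF i j ij] by simp
  finally show "ereal (weight i) * q_inf d m B p v w i j < ereal (weight j)" .
qed (rule weight_pos)

end

section \<open>From the given family to the normalized one\<close>

lemma word_prod_normalized:
  assumes A: "\<forall>k<m. A k \<in> carrier_mat d d" and "u \<in> words m"
  shows "word_prod d (normalized \<rho> A) u = inverse \<rho> ^ length u \<cdot>\<^sub>m word_prod d A u"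
  using assms(2)
proof (induction u)
  case (Cons a u)
  then have a: "A a \<in> carrier_mat d d" and u: "u \<in> words m" using A by (auto simp: words_def)
  note U = word_prod_carrier_mat[OF A u]
  have "inverse \<rho> ^ length u \<cdot>\<^sub>m word_prod d A u * (inverse \<rho> \<cdot>\<^sub>m A a)
      = inverse \<rho> \<cdot>\<^sub>m (inverse \<rho> ^ length u \<cdot>\<^sub>m (word_prod d A u * A a))"
    using mult_smult_distrib[OF smult_carrier_mat[OF U] a] mult_smult_assoc_mat[OF U a] by simp
  also have "\<dots> = inverse \<rho> ^ length (a # u) \<cdot>\<^sub>m (word_prod d A u * A a)"
    by (intro eq_matI) auto
  finally show ?case using Cons.IH[OF u] by (simp add: normalized_def)
qed auto

text \<open>The vectors whose images under all words are orthogonal to \<open>w\<close> form a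
  common invariant subspace. If it contained the nonzero \<open>x\<close>, it would be the whole
  space, but the empty word keeps \<open>y\<close> out of it.\<close>

lemma irreducible_family_connected:
  assumes A: "\<forall>k<m. A k \<in> carrier_mat d d" and irr: "irreducible_family d m A"
    and x: "x \<in> carrier_vec d" "x \<noteq> 0\<^sub>v d" and w: "w \<in> carrier_vec d" and y: "y \<in> carrier_vec d" "w \<bullet> y \<noteq> 0"
  shows "\<exists>u\<in>words m. w \<bullet> (word_prod d A u *\<^sub>v x) \<noteq> 0"
proof (rule ccontr)
  define W where "W = {x \<in> carrier_vec d. \<forall>u\<in>words m. w \<bullet> (word_prod d A u *\<^sub>v x) = 0}"
  note U = word_prod_carrier_mat[OF A]
  assume "\<not> (\<exists>u\<in>words m. w \<bullet> (word_prod d A u *\<^sub>v x) \<noteq> 0)"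
  then have "x \<in> W" using x by (simp add: W_def)
  have "submodule class_ring W (module_vec TYPE(real) d)"
  proof (intro submodule.intro vec_module)
    show "a \<oplus>\<^bsub>module_vec TYPE(real) d\<^esub> b \<in> W" if "a \<in> W" "b \<in> W" for a b
      using that w U unfolding W_def
      by (auto simp: module_vec_simps mult_add_distrib_mat_vec[OF U]
          scalar_prod_add_distrib[OF w mult_mat_vec_carrier[OF U] mult_mat_vec_carrier[OF U]])
    show "c \<odot>\<^bsub>module_vec TYPE(real) d\<^esub> a \<in> W" if "a \<in> W" for c a
      using that unfolding W_def
      by (auto simp: module_vec_simps mult_mat_vec[OF U]
          scalar_prod_smult_distrib[OF w mult_mat_vec_carrier[OF U]])
  qed (use w U in \<open>auto simp: W_def module_vec_simps mult_mat_zero_vec[OF U]\<close>)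
  then have "VectorSpace.subspace class_ring W (module_vec TYPE(real) d)"
    unfolding subspace_def using vec_vs by blast
  moreover have "A i *\<^sub>v z \<in> W" if i: "i < m" and z: "z \<in> W" for i z
  proof -
    have zc: "z \<in> carrier_vec d" using z by (simp add: W_def)
    have Ai: "A i \<in> carrier_mat d d" using A i by simp
    have "w \<bullet> (word_prod d A u *\<^sub>v (A i *\<^sub>v z)) = 0" if u: "u \<in> words m" for u
    proof -
      \<comment> \<open>The head of a word acts first, so \<open>A i\<close> is absorbed by putting
        \<open>i\<close> in front of \<open>u\<close>.\<close>
      have "i # u \<in> words m" using i u by (simp add: words_def)
      then have "w \<bullet> (word_prod d A (i # u) *\<^sub>v z) = 0" using z unfolding W_def by blast
      then show ?thesis using assoc_mult_mat_vec[OF U[OF u] Ai zc] by simp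
    qed
    then show ?thesis using Ai zc by (auto simp: W_def)
  qed
  ultimately consider "W = {0\<^sub>v d}" | "W = carrier_vec d"
    using irr unfolding irreducible_family_def by blast
  then show False
  proof cases
    case 1
    then show ?thesis using \<open>x \<in> W\<close> x by simp
  next
    case 2
    then have "y \<in> W" using y(1) by simp
    then have "w \<bullet> (word_prod d A [] *\<^sub>v y) = 0" using words_Nil unfolding W_def by blast
    then show ?thesis using y by simp
  qed
qed

theorem theorem2:
  fixes d m r :: nat
    and A :: "nat \<Rightarrow> real mat"
    and p :: "nat \<Rightarrow> nat list"
    and \<rho>c :: real
    and v vs :: "nat \<Rightarrow> real vec"
  assumes "d > 0"
    and "\<And>k. k < m \<Longrightarrow> A k \<in> carrier_mat d d"
    and "irreducible_family d m A"
    and "\<And>i. i < r \<Longrightarrow> p i \<in> words m"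
    and "\<And>i. i < r \<Longrightarrow> simple_word (p i)"
    and "\<And>i j. i < r \<Longrightarrow> j < r \<Longrightarrow> i \<noteq> j \<Longrightarrow> \<not> cyclically_equal (p i) (p j)"
    and "dominant d m A r p \<rho>c"
    and "\<And>i. i < r \<Longrightarrow> unique_simple_leading_eigenvalue (word_prod d A (p i))"
    and "\<And>i. i < r \<Longrightarrow> leading_eigenvalue (word_prod d (normalized \<rho>c A) (p i)) 1"
    and "\<And>i. i < r \<Longrightarrow> eigenvector (word_prod d (normalized \<rho>c A) (p i)) (v i) 1"
    and "\<And>i. i < r \<Longrightarrow>
           eigenvector (transpose_mat (word_prod d (normalized \<rho>c A) (p i))) (vs i) 1"
    and "\<And>i. i < r \<Longrightarrow> vs i \<bullet> v i = 1"
  shows "\<exists>\<alpha>. admissible r (q_inf d m (normalized \<rho>c A) p v vs) \<alpha>"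
proof -
  have A: "\<forall>k<m. A k \<in> carrier_mat d d" using assms(2) by blast
  note p = assms(4)
  let ?B = "normalized \<rho>c A"
  have \<rho>: "\<rho>c > 0" using assms(7) by (simp add: dominant_def)
  obtain \<gamma> where \<gamma>: "\<gamma> < 1" and gap: "\<And>u. u \<in> words m \<Longrightarrow> u \<noteq> [] \<Longrightarrow>
       \<not> (\<exists>i<r. \<exists>x k. cyclically_equal x (p i) \<and> u = word_power x k) \<Longrightarrow>
       spectral_radius (cmat (word_prod d ?B u)) < \<gamma>"
    using assms(7) unfolding dominant_def by blast
  note scale = word_prod_normalized[OF A]
  have M: "word_prod d A (p i) \<in> carrier_mat d d" if "i < r" for i
    by (rule word_prod_carrier_mat[OF A p[OF that]])
  have v: "v i \<in> carrier_vec d" "v i \<noteq> 0\<^sub>v d" and w: "vs i \<in> carrier_vec d" if "i < r" for i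
    using assms(10,11)[OF that] M[OF that] unfolding scale[OF p[OF that]] eigenvector_def by auto
  have "dominant_family d m r ?B p v vs \<gamma>"
  proof
    fix i assume i: "i < r"
    show "mat_tendsto d (\<lambda>k. word_prod d ?B (p i) ^\<^sub>m k) (outer_prod d (v i) (vs i))"
      \<comment> \<open>The scaling factor of a normalized product is the inverse of
        \<open>\<rho>c\<close> to the power of the word length.\<close>
      using pow_mat_tendsto_leading_projection[OF assms(1) M[OF i] _ assms(8)[OF i], of "inverse \<rho>c ^ length (p i)"]
        assms(9-12)[OF i] \<rho> unfolding scale[OF p[OF i]] by simp
  next
    fix i j assume i: "i < r" and j: "j < r"
    \<comment> \<open>Irreducibility concerns \<open>A\<close>, so the word is found there; passing
      to the normalized family only multiplies the pairing by a positive factor. The vector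
      \<open>v j\<close> shows that \<open>vs j\<close> is not orthogonal to everything.\<close>
    obtain u where u: "u \<in> words m" "vs j \<bullet> (word_prod d A u *\<^sub>v v i) \<noteq> 0"
      using irreducible_family_connected[OF A assms(3) v[OF i] w[OF j] v(1)[OF j]] assms(12)[OF j] by auto
    have U: "word_prod d A u \<in> carrier_mat d d" by (rule word_prod_carrier_mat[OF A u(1)])
    have "word_prod d ?B u *\<^sub>v v i = inverse \<rho>c ^ length u \<cdot>\<^sub>v (word_prod d A u *\<^sub>v v i)"
      unfolding scale[OF u(1)] using U v[OF i] by (intro eq_vecI) auto
    then have "vs j \<bullet> (word_prod d ?B u *\<^sub>v v i) \<noteq> 0"
      using u(2) \<rho> w[OF j] mult_mat_vec_carrier[OF U v(1)[OF i]] by simp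
    then show "\<exists>u\<in>words m. vs j \<bullet> (word_prod d ?B u *\<^sub>v v i) \<noteq> 0" using u(1) by blast
  qed (use assms \<gamma> gap v w in \<open>auto simp: normalized_def\<close>)
  then show ?thesis using dominant_family.admissible_weight by blast
qed

end
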